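(* Let $(\Omega,\mathcal A,P)$ be a probability space, let $\{A_n, n\ge 1\}$ be a sequence of events in $\mathcal A$, and let $\mathcal F\subseteq\mathcal A$ be a sub-$\sigma$-algebra. Suppose that the series $\sum_i P(A_i\mid\mathcal F)$ converges almost surely with rate of convergence $\phi$, where $\phi=\{\phi(\ell),\ \ell\ge 0\}$ is a random function with values in the positive integers; that is, almost surely, for all integers $\ell\ge 0$ and all integers $m>\phi(\ell)$, $$\sum_{i=\phi(\ell)}^m P(A_i\mid\mathcal F)\le\frac1{2^\ell}.$$ Then, almost surely, for all integers $\ell\ge 0$ and all integers $m>\phi(\ell)$, $$P\Big(\bigcup_{i=\phi(\ell)}^m A_i\,\Big|\,\mathcal F\Big)\le\frac1{2^\ell}.$$
   Context: $P(A\mid\mathcal F)=E[\mathbf 1_A\mid\mathcal F]$; for each of the countably many events involved a version of the conditional probability is fixed. "Random function" means that $\phi(\ell)$ may depend on $\omega\in\Omega$. Expressions with a random index are evaluated pointwise: at $\omega$, $\sum_{i=\phi(\ell)}^m P(A_i\mid\mathcal F)$ and $P(\bigcup_{i=\phi(\ell)}^m A_i\mid\mathcal F)$ mean $\sum_{i=a}^m P(A_i\mid\mathcal F)(\omega)$ and $P(\bigcup_{i=a}^m A_i\mid\mathcal F)(\omega)$ with $a=\phi(\ell)(\omega)$. *)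

theory Defs
  imports "HOL-Probability.Probability"
begin

text \<open>
  \<open>q\<close> is a version of the conditional probability of \<open>B\<close> given the sub-sigma-algebra \<open>F\<close>
  of \<open>M\<close>, i.e. of the conditional expectation of the indicator of \<open>B\<close>. The library's
  \<^const>\<open>real_cond_exp\<close> is one particular version; every other one is \<open>F\<close>-measurable and agrees
  with it almost surely.
\<close>

definition cond_prob_version :: "'a measure \<Rightarrow> 'a measure \<Rightarrow> 'a set \<Rightarrow> ('a \<Rightarrow> real) \<Rightarrow> bool" where
  "cond_prob_version M F B q \<longleftrightarrow>
     q \<in> borel_measurable F \<and> (AE \<omega> in M. q \<omega> = real_cond_exp M F (indicator B) \<omega>)"

end

theory Submission
  imports Defs
begin

text \<open>For fixed integers the claim is the conditional union bound: the indicator of a finite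
  union is at most the sum of the indicators, and conditional expectation is monotone and additive
  almost surely. The exceptional null set depends on the endpoints \<open>a\<close> and
  \<open>m\<close>, but there are only countably many pairs, so one null set serves them all. Off it
  the random index \<open>\<phi> l \<omega>\<close> can be substituted for \<open>a\<close>
  pointwise.\<close>

lemma (in finite_measure) cond_prob_version_UN_le_sum:
  assumes sub: "subalgebra M F"
    and I: "finite I"
    and A: "\<And>i. i \<in> I \<Longrightarrow> A i \<in> sets M"
    and q: "\<And>i. i \<in> I \<Longrightarrow> cond_prob_version M F (A i) (q i)"
    and r: "cond_prob_version M F (\<Union>i\<in>I. A i) r"
  shows "AE \<omega> in M. r \<omega> \<le> (\<Sum>i\<in>I. q i \<omega>)"
proof -
  interpret finite_measure_subalgebra M F
    by unfold_locales (rule sub)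
  have int: "integrable M (indicator B :: _ \<Rightarrow> real)" if "B \<in> sets M" for B
    using that by (intro integrable_real_indicator) (auto simp: less_top[symmetric])
  have le: "indicator (\<Union>i\<in>I. A i) \<omega> \<le> (\<Sum>i\<in>I. indicator (A i) \<omega> :: real)" for \<omega>
  proof (cases "\<omega> \<in> (\<Union>i\<in>I. A i)")
    case True
    then obtain j where "j \<in> I" "\<omega> \<in> A j"
      by blast
    then show ?thesis
      \<comment> \<open>The \<open>j\<close>-th summand is already 1 and the others are
        nonnegative.\<close>
      using True I member_le_sum[of j I "\<lambda>i. indicator (A i) \<omega> :: real"] by simp
  qed (simp add: sum_nonneg)
  have U: "(\<Union>i\<in>I. A i) \<in> sets M"
    using A I by blast
  have "AE \<omega> in M. real_cond_exp M F (indicator (\<Union>i\<in>I. A i)) \<omega>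
      \<le> real_cond_exp M F (\<lambda>\<omega>. \<Sum>i\<in>I. indicator (A i) \<omega>) \<omega>"
    using le int U A by (intro real_cond_exp_mono) auto
  moreover have "AE \<omega> in M. real_cond_exp M F (\<lambda>\<omega>. \<Sum>i\<in>I. indicator (A i) \<omega>) \<omega>
      = (\<Sum>i\<in>I. real_cond_exp M F (indicator (A i)) \<omega>)"
    \<comment> \<open>\<open>real_cond_exp_sum\<close> wants integrability at every index, while
      \<open>A i\<close> is known to be measurable only for \<open>i \<in> I\<close>; hence the
      padding by the empty set.\<close>
    using real_cond_exp_sum[of "\<lambda>i. indicator (if i \<in> I then A i else {})" I] int A
    by (simp cong: sum.cong)
  moreover have "AE \<omega> in M. \<forall>i\<in>I. q i \<omega> = real_cond_exp M F (indicator (A i)) \<omega>"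
    using q I by (intro AE_finite_allI) (auto simp: cond_prob_version_def)
  moreover have "AE \<omega> in M. r \<omega> = real_cond_exp M F (indicator (\<Union>i\<in>I. A i)) \<omega>"
    using r by (simp add: cond_prob_version_def)
  ultimately show ?thesis
    by eventually_elim simp
qed

theorem theorem3p3:
  fixes M F :: "'a measure"
    and A :: "nat \<Rightarrow> 'a set"
    and Q :: "'a set \<Rightarrow> 'a \<Rightarrow> real"
    and \<phi> :: "nat \<Rightarrow> 'a \<Rightarrow> nat"
  assumes "prob_space M"
    and "subalgebra M F"
    and "\<And>n. n \<ge> 1 \<Longrightarrow> A n \<in> sets M"
    and "\<And>n. n \<ge> 1 \<Longrightarrow> cond_prob_version M F (A n) (Q (A n))"
    and "\<And>a m. 1 \<le> a \<Longrightarrow> a < m \<Longrightarrow>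
           cond_prob_version M F (\<Union>i\<in>{a..m}. A i) (Q (\<Union>i\<in>{a..m}. A i))"
    and "\<And>l \<omega>. \<omega> \<in> space M \<Longrightarrow> \<phi> l \<omega> \<ge> 1"
    and "AE \<omega> in M. \<forall>l. \<forall>m > \<phi> l \<omega>. (\<Sum>i = \<phi> l \<omega>..m. Q (A i) \<omega>) \<le> 1 / 2 ^ l"
  shows "AE \<omega> in M. \<forall>l. \<forall>m > \<phi> l \<omega>. Q (\<Union>i\<in>{\<phi> l \<omega>..m}. A i) \<omega> \<le> 1 / 2 ^ l"
proof -
  interpret prob_space M by fact
  \<comment> \<open>The range conditions sit inside the AE so that the statement holds for every
    pair and can be intersected over all of them.\<close>
  have "AE \<omega> in M. 1 \<le> a \<longrightarrow> a < m \<longrightarrow> Q (\<Union>i\<in>{a..m}. A i) \<omega> \<le> (\<Sum>i = a..m. Q (A i) \<omega>)" for a m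
  proof (cases "1 \<le> a \<and> a < m")
    case True
    then have "AE \<omega> in M. Q (\<Union>i\<in>{a..m}. A i) \<omega> \<le> (\<Sum>i = a..m. Q (A i) \<omega>)"
      using assms(2-5) by (intro cond_prob_version_UN_le_sum[where A = A]) auto
    then show ?thesis
      by eventually_elim simp
  qed auto
  then have "AE \<omega> in M. \<forall>a m. 1 \<le> a \<longrightarrow> a < m \<longrightarrow>
      Q (\<Union>i\<in>{a..m}. A i) \<omega> \<le> (\<Sum>i = a..m. Q (A i) \<omega>)"
    by (simp add: AE_all_countable)
  \<comment> \<open>The bound is used at \<open>a = \<phi> l \<omega>\<close>;
    \<open>AE_space\<close> supplies \<open>\<omega> \<in> space M\<close>, where this index is at
    least 1. No measurability of \<open>\<phi>\<close> enters, as \<omega> is fixed here.\<close>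
  with assms(7) AE_space show ?thesis
  proof eventually_elim
    case (elim \<omega>)
    then show ?case
      using assms(6) by (meson order_trans)
  qed
qed

end
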